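(* Let $L$ be a positive definite even lattice, $k\in\frac12\mathbb Z$, $t\in\mathbb Q_{>0}$, $D\in\mathbb Z$, $\nu:H_s(L)\to\{\pm1\}$ a character, and $\chi=v_\eta^D\times\nu$. 1. If $L(t)$ is an even lattice, then $J_{k,L;t}(\chi)=J_{k,L(t);1}(\chi)$. If this space is non-trivial, then the Heisenberg part $\nu=\chi|_{H_s(L)}$ of the character is trivial. 2. If $L(t)$ is an integral odd (non-even) lattice, then $J_{k,L;t}(\chi)=J_{k,L(2t);\frac12}(\chi)$. In this case, if the space is non-trivial, the character $\nu=\chi|_{H_s(L)}$ is of order $2$. 3. If $\varphi(\tau,\mathfrak Z)\in J_{k,L;t}(v_\eta^D\times\nu)$, then $\varphi(\tau,2\mathfrak Z)\in J_{k,L;4t}(v_\eta^D\times\mathrm{id})$.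
   Context: **Lattices.** A lattice is a free $\mathbb Z$-module of finite rank with a non-degenerate symmetric $\mathbb Z$-valued bilinear form (integral); it is even if $(l,l)\in2\mathbb Z$ for all $l$, odd otherwise. $L^\vee$ is the dual lattice; the form is extended bilinearly to $L\otimes\mathbb C$. For rational $N>0$, $L(N)$ denotes the module $L$ equipped with the form $N(\cdot,\cdot)$. $\mathbb H$ is the upper half-plane. **Multiplier.** For $A=\begin{pmatrix}a&b\\c&d\end{pmatrix}\in\mathrm{SL}_2(\mathbb Z)$, $v_\eta(A)$ is defined by $\eta(\frac{a\tau+b}{c\tau+d})=v_\eta(A)(c\tau+d)^{1/2}\eta(\tau)$ with $\eta$ the Dedekind eta function. Half-integral powers use the principal branch. **Heisenberg group.** $H(L)=\{[x,y;r]: x,y\in L,\ r\in\frac12\mathbb Z,\ r+\frac12(x,y)\in\mathbb Z\}$ with product $[x,y;r][x',y';r']=[x+x',y+y';r+r'+\frac12((x,y')-(x',y))]$; $H_s(L)$ is the subgroup generated by all $[x,0;0]$ and $[0,y;0]$ ($x,y\in L$); it contains $[x,y;\frac12(x,y)]=[x,0;0][0,y;0]$. When $L(N)$ is even, $H_s(L)$ and $H_s(L(N))$ are identified by $[x,y;r]\leftrightarrow[x,y;Nr]$, so that a character of one is regarded as a character of the other. **Jacobi forms.** $J_{k,L;t}(v_\eta^D\times\nu)$ is the space of holomorphic $\varphi:\mathbb H\times(L\otimes\mathbb C)\to\mathbb C$ with (i) $\varphi(\frac{a\tau+b}{c\tau+d},\frac{\mathfrak Z}{c\tau+d})=v_\eta^D(A)(c\tau+d)^ke^{\pi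 i t\frac{c(\mathfrak Z,\mathfrak Z)}{c\tau+d}}\varphi(\tau,\mathfrak Z)$ for $A\in\mathrm{SL}_2(\mathbb Z)$; (ii) $\varphi(\tau,\mathfrak Z+x\tau+y)=\nu([x,y;\frac12(x,y)])e^{-\pi i t((x,x)\tau+2(x,\mathfrak Z))}\varphi(\tau,\mathfrak Z)$ for $x,y\in L$; (iii) a Fourier expansion $\varphi(\tau,\mathfrak Z)=\sum f(n,l)e^{2\pi i(n\tau+(l,\mathfrak Z))}$, the sum over $n\in\mathbb Q_{\ge0}$, $n\equiv\frac D{24}\bmod\mathbb Z$, $l\in\frac12L^\vee$ with $2nt-(l,l)\ge0$. For $J_{k,L(t);1}$ and $J_{k,L(2t);1/2}$ the same definition is used with the form (and dual lattice) of $L(t)$, $L(2t)$. Equalities are equalities of spaces of functions on $\mathbb H\times(L\otimes\mathbb C)$. $\mathrm{id}$ is the trivial character. *)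

theory Defs
  imports "HOL-Analysis.Analysis" "HOL-Algebra.Sym_Groups"
begin

text \<open>
  A lattice \<open>L\<close> is realised inside some \<open>complex^'n\<close> as the integral span of a set that is
  linearly independent over the complex numbers (so its rank is any number between \<open>0\<close> and
  \<open>CARD('n)\<close>). Then \<open>L \<otimes> \<complex>\<close> is the complex span \<open>vec.span L\<close>, and the bilinear form is given
  by its complex bilinear extension. The values of \<open>bil\<close> outside \<open>vec.span L\<close> are irrelevant.
\<close>

record 'v lat =
  pts :: "'v set"
  bil :: "'v \<Rightarrow> 'v \<Rightarrow> complex"

definition tensorC :: "(complex^'n) lat \<Rightarrow> (complex^'n) set" where
  "tensorC L = vec.span (pts L)"

definition tensorQ :: "(complex^'n) lat \<Rightarrow> (complex^'n) set" where
  "tensorQ L = {v. \<exists>m::int. m > 0 \<and> of_int m *s v \<in> pts L}"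

definition is_lattice :: "(complex^'n) lat \<Rightarrow> bool" where
  "is_lattice L \<longleftrightarrow>
     (\<exists>B. finite B \<and> vec.independent B \<and>
          pts L = {\<Sum>v\<in>B. of_int (c v) *s v |c :: complex^'n \<Rightarrow> int. True}) \<and>
     (\<forall>x\<in>tensorC L. \<forall>y\<in>tensorC L. \<forall>z\<in>tensorC L. bil L (x + y) z = bil L x z + bil L y z) \<and>
     (\<forall>c. \<forall>x\<in>tensorC L. \<forall>y\<in>tensorC L. bil L (c *s x) y = c * bil L x y) \<and>
     (\<forall>x\<in>tensorC L. \<forall>y\<in>tensorC L. bil L x y = bil L y x) \<and>
     (\<forall>x\<in>pts L. \<forall>y\<in>pts L. bil L x y \<in> \<int>) \<and>
     (\<forall>x\<in>pts L. (\<forall>y\<in>pts L. bil L x y = 0) \<longrightarrow> x = 0)"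

definition even_lattice :: "(complex^'n) lat \<Rightarrow> bool" where
  "even_lattice L \<longleftrightarrow> is_lattice L \<and> (\<forall>l\<in>pts L. \<exists>m::int. bil L l l = of_int (2 * m))"

definition odd_lattice :: "(complex^'n) lat \<Rightarrow> bool" where
  "odd_lattice L \<longleftrightarrow> is_lattice L \<and> \<not> even_lattice L"

text \<open>On \<open>L\<close> the form is integer-valued, so taking real parts loses nothing.\<close>

definition positive_definite :: "(complex^'n) lat \<Rightarrow> bool" where
  "positive_definite L \<longleftrightarrow> (\<forall>x\<in>pts L. x \<noteq> 0 \<longrightarrow> Re (bil L x x) > 0)"

definition dual :: "(complex^'n) lat \<Rightarrow> (complex^'n) set" where
  "dual L = {v\<in>tensorQ L. \<forall>x\<in>pts L. bil L v x \<in> \<int>}"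

text \<open>\<open>rescale N L\<close> is \<open>L(N)\<close>; it need not be integral.\<close>

definition rescale :: "rat \<Rightarrow> (complex^'n) lat \<Rightarrow> (complex^'n) lat" where
  "rescale N L = L\<lparr>bil := \<lambda>x y. of_rat N * bil L x y\<rparr>"

text \<open>The triple \<open>(x, y, r)\<close> stands for \<open>[x, y; r]\<close>; the central coordinate \<open>r\<close> lies in
  \<open>1/2 \<int>\<close> but is given the type of the values of the form.\<close>

type_synonym 'v heis = "'v \<times> 'v \<times> complex"

definition heisenberg :: "(complex^'n) lat \<Rightarrow> (complex^'n) heis monoid" where
  "heisenberg L =
     \<lparr>carrier = {(x, y, r). x \<in> pts L \<and> y \<in> pts L \<and> 2 * r \<in> \<int> \<and> r + bil L x y / 2 \<in> \<int>},
      mult = (\<lambda>(x, y, r) (x', y', r').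
                (x + x', y + y', r + r' + (bil L x y' - bil L x' y) / 2)),
      one = (0, 0, 0)\<rparr>"

definition heisenberg_s :: "(complex^'n) lat \<Rightarrow> (complex^'n) heis set" where
  "heisenberg_s L =
     generate (heisenberg L) ({(x, 0, 0) |x. x \<in> pts L} \<union> {(0, y, 0) |y. y \<in> pts L})"

text \<open>\<open>sign_img\<close> is the multiplicative group \<open>{-1, 1}\<close> of integers.\<close>

definition characters :: "(complex^'n) lat \<Rightarrow> ((complex^'n) heis \<Rightarrow> int) set" where
  "characters L = hom ((heisenberg L)\<lparr>carrier := heisenberg_s L\<rparr>) sign_img"

definition char_trivial :: "(complex^'n) lat \<Rightarrow> ((complex^'n) heis \<Rightarrow> int) \<Rightarrow> bool" where
  "char_trivial L \<nu> \<longleftrightarrow> (\<forall>g\<in>heisenberg_s L. \<nu> g = 1)"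

definition char_has_order :: "(complex^'n) lat \<Rightarrow> ((complex^'n) heis \<Rightarrow> int) \<Rightarrow> nat \<Rightarrow> bool" where
  "char_has_order L \<nu> m \<longleftrightarrow> m > 0 \<and> char_trivial L (\<lambda>g. \<nu> g ^ m) \<and>
     (\<forall>j. 0 < j \<and> j < m \<longrightarrow> \<not> char_trivial L (\<lambda>g. \<nu> g ^ j))"

text \<open>A character of \<open>H\<^sub>s(L)\<close> regarded as a character of \<open>H\<^sub>s(L(N))\<close>, through the identification
  of \<open>[x, y; r]\<close> in \<open>H\<^sub>s(L)\<close> with \<open>[x, y; N r]\<close> in \<open>H\<^sub>s(L(N))\<close>.\<close>

definition transport_char ::
  "rat \<Rightarrow> ((complex^'n) heis \<Rightarrow> int) \<Rightarrow> ((complex^'n) heis \<Rightarrow> int)" where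
  "transport_char N \<nu> = (\<lambda>(x, y, r). \<nu> (x, y, r / of_rat N))"

definition upper_half_plane :: "complex set" where
  "upper_half_plane = {\<tau>. Im \<tau> > 0}"

definition dedekind_eta :: "complex \<Rightarrow> complex" where
  "dedekind_eta \<tau> = exp (2 * pi * \<i> * \<tau> / 24) * (\<Prod>n. 1 - exp (2 * pi * \<i> * of_nat (Suc n) * \<tau>))"

text \<open>\<open>v_eta a b c d\<close> is the multiplier at the matrix with rows \<open>(a, b)\<close> and \<open>(c, d)\<close>.
  Complex \<open>powr\<close> is the principal branch.\<close>

definition v_eta :: "int \<Rightarrow> int \<Rightarrow> int \<Rightarrow> int \<Rightarrow> complex" where
  "v_eta a b c d = (THE v. \<forall>\<tau>\<in>upper_half_plane.
     dedekind_eta ((of_int a * \<tau> + of_int b) / (of_int c * \<tau> + of_int d)) =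
       v * (of_int c * \<tau> + of_int d) powr (1/2) * dedekind_eta \<tau>)"

definition jacobi_domain :: "(complex^'n) lat \<Rightarrow> (complex \<times> (complex^'n)) set" where
  "jacobi_domain L = upper_half_plane \<times> tensorC L"

text \<open>Holomorphy in several variables: the real derivative exists and is complex linear.
  The derivative is taken within the domain since \<open>L \<otimes> \<complex>\<close> may be a proper subspace of
  \<open>complex^'n\<close>.\<close>

definition holomorphic_on_domain ::
  "(complex \<times> (complex^'n) \<Rightarrow> complex) \<Rightarrow> (complex \<times> (complex^'n)) set \<Rightarrow> bool" where
  "holomorphic_on_domain \<phi> X \<longleftrightarrow>
     (\<forall>p\<in>X. \<exists>\<phi>'. (\<phi> has_derivative \<phi>') (at p within X) \<and>
        (\<forall>c u v. \<phi>' (c * u, c *s v) = c * \<phi>' (u, v)))"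

text \<open>The index set of the Fourier expansion. The form is real-valued (indeed rational)
  on \<open>L \<otimes> \<rat>\<close>, hence on the half dual lattice.\<close>

definition fourier_index :: "(complex^'n) lat \<Rightarrow> rat \<Rightarrow> int \<Rightarrow> (rat \<times> (complex^'n)) set" where
  "fourier_index L t D =
     {(n, l). n \<ge> 0 \<and> n - of_int D / 24 \<in> \<int> \<and> l \<in> {(1/2) *s m |m. m \<in> dual L} \<and>
              2 * of_rat n * of_rat t - Re (bil L l l) \<ge> 0}"

text \<open>\<open>jacobi_forms k L t D \<nu>\<close> is the space of Jacobi forms of weight \<open>k\<close> and index \<open>t\<close> on \<open>L\<close> with
  character \<open>v_eta\<^sup>D \<times> \<nu>\<close>. A function on the domain is a HOL function that is \<open>undefined\<close> outside it,
  so that equality of sets of such functions is equality of spaces of functions on the domain.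
  The Fourier series is required to converge unconditionally (equivalently, absolutely) at each
  point.\<close>

definition jacobi_forms ::
  "rat \<Rightarrow> (complex^'n) lat \<Rightarrow> rat \<Rightarrow> int \<Rightarrow> ((complex^'n) heis \<Rightarrow> int) \<Rightarrow>
   (complex \<times> (complex^'n) \<Rightarrow> complex) set" where
  "jacobi_forms k L t D \<nu> = {\<phi> \<in> extensional (jacobi_domain L).
     holomorphic_on_domain \<phi> (jacobi_domain L) \<and>
     (\<forall>a b c d :: int. a * d - b * c = 1 \<longrightarrow>
        (\<forall>\<tau>\<in>upper_half_plane. \<forall>z\<in>tensorC L.
           \<phi> ((of_int a * \<tau> + of_int b) / (of_int c * \<tau> + of_int d),
              (1 / (of_int c * \<tau> + of_int d)) *s z) =
           v_eta a b c d powi D * (of_int c * \<tau> + of_int d) powr of_rat k *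
           exp (pi * \<i> * of_rat t * (of_int c * bil L z z / (of_int c * \<tau> + of_int d))) *
           \<phi> (\<tau>, z))) \<and>
     (\<forall>\<tau>\<in>upper_half_plane. \<forall>z\<in>tensorC L. \<forall>x\<in>pts L. \<forall>y\<in>pts L.
        \<phi> (\<tau>, z + \<tau> *s x + y) =
        of_int (\<nu> (x, y, bil L x y / 2)) *
        exp (- pi * \<i> * of_rat t * (bil L x x * \<tau> + 2 * bil L x z)) * \<phi> (\<tau>, z)) \<and>
     (\<exists>f :: rat \<Rightarrow> complex^'n \<Rightarrow> complex. \<forall>\<tau>\<in>upper_half_plane. \<forall>z\<in>tensorC L.
        ((\<lambda>(n, l). f n l * exp (2 * pi * \<i> * (of_rat n * \<tau> + bil L l z))) has_sum \<phi> (\<tau>, z))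
          (fourier_index L t D))}"

definition nontrivial_space ::
  "(complex^'n) lat \<Rightarrow> (complex \<times> (complex^'n) \<Rightarrow> complex) set \<Rightarrow> bool" where
  "nontrivial_space L J \<longleftrightarrow> (\<exists>\<phi>\<in>J. \<exists>p\<in>jacobi_domain L. \<phi> p \<noteq> 0)"

end

theory Submission
  imports Defs
begin

text \<open>
  The equalities of spaces hold for every rational rescaling factor \<open>s > 0\<close>: the index \<open>t\<close> and the
  form \<open>(\<cdot>,\<cdot>)\<close> enter the two transformation laws only through \<open>t (\<cdot>,\<cdot>)\<close>, which is unchanged when
  \<open>L\<close> is replaced by \<open>L(s)\<close> and \<open>t\<close> by \<open>t / s\<close>, and the substitution \<open>l = s l'\<close> is a bijection of
  the Fourier index sets that preserves the exponents (\<open>jacobi_forms_rescale\<close>). The cases \<open>s = t\<close>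
  and \<open>s = 2 t\<close> give the two asserted equalities.

  A Jacobi form that does not vanish identically determines its Heisenberg character. Comparing the
  translation by \<open>x \<tau> + x\<close> at \<open>\<tau>\<close> with the translation by \<open>x (\<tau> + 1)\<close> at \<open>\<tau> + 1\<close> by means of
  \<open>\<tau> \<mapsto> \<tau> + 1\<close> yields \<open>\<nu>([0,x;0]) = exp(-\<pi> i t (x,x))\<close> (\<open>jacobi_character_snd\<close>), and the inversion
  \<open>\<tau> \<mapsto> -1/\<tau>\<close> exchanges the two kinds of translation, so \<open>\<nu>([x,0;0]) = \<nu>([0,x;0])\<close>
  (\<open>jacobi_character_fst\<close>). Hence \<open>\<nu>\<close> is trivial when all \<open>t (x,x)\<close> are even, and takes the value
  \<open>-1\<close> when some \<open>t (x,x)\<close> is odd. No property of the eta multiplier is needed except that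
  its \<open>D\<close>-th power does not vanish at the two matrices used, and this is forced by the existence of
  a non-zero form.

  For \<open>\<phi>(\<tau>, 2z)\<close> both transformation laws follow from those of \<open>\<phi>\<close> with \<open>2x\<close>, \<open>2y\<close>, \<open>2z\<close> in place
  of \<open>x\<close>, \<open>y\<close>, \<open>z\<close>; the character disappears because its values are signs, and the Fourier
  expansion is reindexed by \<open>l \<mapsto> 2l\<close> (\<open>jacobi_forms_double\<close>).
\<close>

lemma of_real_of_rat_complex: "complex_of_real (of_rat q) = of_rat q"
  by (cases q) (simp add: of_rat_rat)

section \<open>Lattices and their rescalings\<close>

lemma lattice_bil:
  assumes "is_lattice L"
  shows bil_add_left: "\<lbrakk>x \<in> tensorC L; y \<in> tensorC L; z \<in> tensorC L\<rbrakk> \<Longrightarrow>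
      bil L (x + y) z = bil L x z + bil L y z"
    and bil_scale_left: "\<lbrakk>x \<in> tensorC L; y \<in> tensorC L\<rbrakk> \<Longrightarrow> bil L (c *s x) y = c * bil L x y"
    and bil_sym: "\<lbrakk>x \<in> tensorC L; y \<in> tensorC L\<rbrakk> \<Longrightarrow> bil L x y = bil L y x"
    and bil_int: "\<lbrakk>x \<in> pts L; y \<in> pts L\<rbrakk> \<Longrightarrow> bil L x y \<in> \<int>"
  using assms by (auto simp: is_lattice_def)

lemma tensorC_closed:
  shows tensorC_0: "0 \<in> tensorC L"
    and tensorC_add: "\<lbrakk>x \<in> tensorC L; y \<in> tensorC L\<rbrakk> \<Longrightarrow> x + y \<in> tensorC L"
    and tensorC_scale: "x \<in> tensorC L \<Longrightarrow> c *s x \<in> tensorC L"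
    and pts_tensorC: "x \<in> pts L \<Longrightarrow> x \<in> tensorC L"
  by (auto simp: tensorC_def vec.span_zero vec.span_add vec.span_scale vec.span_base)

lemma bil_add_right:
  assumes "is_lattice L" "x \<in> tensorC L" "y \<in> tensorC L" "z \<in> tensorC L"
  shows "bil L z (x + y) = bil L z x + bil L z y"
  using assms by (metis bil_add_left bil_sym tensorC_add)

lemma bil_scale_right:
  assumes "is_lattice L" "x \<in> tensorC L" "y \<in> tensorC L"
  shows "bil L y (c *s x) = c * bil L y x"
  using assms by (metis bil_scale_left bil_sym tensorC_scale)

lemma bil_0_left: "\<lbrakk>is_lattice L; x \<in> tensorC L\<rbrakk> \<Longrightarrow> bil L 0 x = 0"
  using bil_scale_left[of L 0 x 0] by (simp add: tensorC_0)

lemma bil_0_right: "\<lbrakk>is_lattice L; x \<in> tensorC L\<rbrakk> \<Longrightarrow> bil L x 0 = 0"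
  using bil_0_left bil_sym tensorC_0 by metis

lemma pts_closed:
  assumes "is_lattice L"
  shows pts_0: "0 \<in> pts L"
    and pts_scale: "x \<in> pts L \<Longrightarrow> of_int m *s x \<in> pts L"
proof -
  obtain B where pts: "pts L = {\<Sum>v\<in>B. of_int (c v) *s v |c :: complex^'a \<Rightarrow> int. True}"
    using assms by (auto simp: is_lattice_def)
  have comb: "(\<Sum>v\<in>B. of_int (c v) *s v) \<in> pts L" for c
    unfolding pts by blast
  show "0 \<in> pts L"
    using comb[of "\<lambda>_. 0"] by simp
  show "of_int m *s x \<in> pts L" if x: "x \<in> pts L"
  proof -
    obtain c :: "complex^'a \<Rightarrow> int" where "x = (\<Sum>v\<in>B. of_int (c v) *s v)"
      using x unfolding pts by auto
    then show ?thesis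
      using comb[of "\<lambda>v. m * c v"] by (simp add: vec.scale_sum_right)
  qed
qed

lemma tensorQ_tensorC:
  assumes "v \<in> tensorQ L"
  shows "v \<in> tensorC L"
proof -
  obtain m :: int where "m > 0" "of_int m *s v \<in> pts L"
    using assms by (auto simp: tensorQ_def)
  then show ?thesis
    using tensorC_scale[OF pts_tensorC, of "of_int m *s v" L "1 / of_int m"] by simp
qed

lemma tensorQ_scale:
  assumes "is_lattice L" "v \<in> tensorQ L"
  shows "of_rat s *s v \<in> tensorQ L"
proof -
  obtain m :: int where m: "m > 0" "of_int m *s v \<in> pts L"
    using assms by (auto simp: tensorQ_def)
  obtain p q where s: "s = Fract p q" "q > 0"
    by (cases s) auto
  have "of_int (q * m) *s (of_rat s *s v) = of_int p *s (of_int m *s v)"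
    using s by (simp add: of_rat_rat mult.commute)
  then have "of_int (q * m) *s (of_rat s *s v) \<in> pts L"
    using pts_scale[OF assms(1) m(2)] by (simp only:)
  moreover have "q * m > 0"
    using m s by simp
  ultimately show ?thesis
    unfolding tensorQ_def by blast
qed

lemma rescale_simps [simp]:
  "pts (rescale s L) = pts L" "bil (rescale s L) x y = of_rat s * bil L x y"
  "tensorC (rescale s L) = tensorC L" "tensorQ (rescale s L) = tensorQ L"
  "jacobi_domain (rescale s L) = jacobi_domain L"
  by (simp_all add: rescale_def tensorC_def tensorQ_def jacobi_domain_def)

text \<open>The dual lattice of \<open>L(s)\<close> is \<open>s\<inverse> L\<^sup>\<or>\<close>.\<close>

lemma dual_rescale_iff:
  assumes "is_lattice L" "s \<noteq> 0"
  shows "v \<in> dual (rescale s L) \<longleftrightarrow> of_rat s *s v \<in> dual L"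
proof -
  have "of_rat s *s v \<in> tensorQ L \<longleftrightarrow> v \<in> tensorQ L"
  proof
    assume "of_rat s *s v \<in> tensorQ L"
    from tensorQ_scale[OF assms(1) this, of "1 / s"] assms(2)
    show "v \<in> tensorQ L" by (simp add: of_rat_divide)
  qed (rule tensorQ_scale[OF assms(1)])
  moreover have "bil L (of_rat s *s v) x = of_rat s * bil L v x" if "v \<in> tensorQ L" "x \<in> pts L" for x
    using that assms(1) by (simp add: bil_scale_left pts_tensorC tensorQ_tensorC)
  ultimately show ?thesis
    by (auto simp: dual_def)
qed

lemma dual_scale_int:
  assumes "is_lattice L" "v \<in> dual L"
  shows "of_int m *s v \<in> dual L"
  using assms tensorQ_scale[of L v "of_int m"]
  by (auto simp: dual_def bil_scale_left pts_tensorC tensorQ_tensorC)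

text \<open>Membership in \<open>1/2 L\<^sup>\<or>\<close> is expressed as \<open>2 l \<in> L\<^sup>\<or>\<close>.\<close>

lemma fourier_index_iff:
  "(n, l) \<in> fourier_index L t D \<longleftrightarrow> n \<ge> 0 \<and> n - of_int D / 24 \<in> \<int> \<and> 2 *s l \<in> dual L \<and>
    2 * of_rat n * of_rat t - Re (bil L l l) \<ge> 0"
proof -
  have "(\<exists>m. l = (1/2) *s m \<and> m \<in> dual L) \<longleftrightarrow> 2 *s l \<in> dual L"
  proof
    assume "2 *s l \<in> dual L"
    moreover have "l = (1/2) *s (2 *s l)" by simp
    ultimately show "\<exists>m. l = (1/2) *s m \<and> m \<in> dual L" by blast
  qed auto
  then show ?thesis
    by (simp add: fourier_index_def)
qed

lemma fourier_index_tensorC: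
  assumes "(n, l) \<in> fourier_index L t D"
  shows "l \<in> tensorC L"
proof -
  have "(1/2) *s (2 *s l) \<in> tensorC L"
    using assms by (intro tensorC_scale tensorQ_tensorC) (simp add: fourier_index_iff dual_def)
  then show ?thesis by simp
qed

lemma fourier_index_rescale_iff:
  assumes "is_lattice L" "s > 0"
  shows "(n, l) \<in> fourier_index (rescale s L) (t / s) D \<longleftrightarrow>
    (n, of_rat s *s l) \<in> fourier_index L t D"
proof -
  have "2 *s l \<in> dual (rescale s L) \<longleftrightarrow> 2 *s (of_rat s *s l) \<in> dual L"
    using dual_rescale_iff[of L s "2 *s l"] assms by (simp add: mult.commute)
  moreover have "(2 * real_of_rat n * real_of_rat (t / s) - Re (of_rat s * bil L l l) \<ge> 0) \<longleftrightarrow>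
      (2 * real_of_rat n * real_of_rat t - Re (bil L (of_rat s *s l) (of_rat s *s l)) \<ge> 0)"
    if "2 *s (of_rat s *s l) \<in> dual L"
  proof -
    have "(1 / (2 * of_rat s)) *s (2 *s (of_rat s *s l)) \<in> tensorC L"
      using that by (intro tensorC_scale tensorQ_tensorC) (simp add: dual_def)
    then have l: "l \<in> tensorC L"
      using assms(2) by simp
    have re: "Re (of_rat q * w) = real_of_rat q * Re w" for q w
      unfolding of_real_of_rat_complex[symmetric] by simp
    have "bil L (of_rat s *s l) (of_rat s *s l) = of_rat s * (of_rat s * bil L l l)"
      using l assms(1) by (simp add: bil_scale_left bil_scale_right tensorC_scale)
    then have "Re (bil L (of_rat s *s l) (of_rat s *s l)) =
        real_of_rat s * (real_of_rat s * Re (bil L l l))"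
      by (simp only: re)
    moreover have "Re (of_rat s * bil L l l) = real_of_rat s * Re (bil L l l)"
      by (rule re)
    ultimately have "2 * real_of_rat n * real_of_rat t - Re (bil L (of_rat s *s l) (of_rat s *s l)) =
      real_of_rat s * (2 * real_of_rat n * real_of_rat (t / s) - Re (of_rat s * bil L l l))"
      using assms(2) by (simp only: of_rat_divide) (simp add: algebra_simps)
    then show ?thesis
      using assms(2) by (simp add: zero_le_mult_iff)
  qed
  ultimately show ?thesis
    unfolding fourier_index_iff rescale_simps by blast
qed


section \<open>Changing the index by rescaling the lattice\<close>

text \<open>Substituting \<open>l = s l'\<close> identifies Fourier series over the index sets of \<open>L\<close> and \<open>L(s)\<close>.\<close>

lemma fourier_expansion_rescale_iff:
  fixes L :: "(complex^'n) lat"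
  assumes L: "is_lattice L" and "s > 0"
  shows "(\<exists>f :: rat \<Rightarrow> complex^'n \<Rightarrow> complex. \<forall>\<tau>\<in>upper_half_plane. \<forall>z\<in>tensorC L.
        ((\<lambda>(n, l). f n l * exp (2 * pi * \<i> * (of_rat n * \<tau> + bil (rescale s L) l z)))
          has_sum \<phi> (\<tau>, z)) (fourier_index (rescale s L) (t / s) D)) \<longleftrightarrow>
    (\<exists>f :: rat \<Rightarrow> complex^'n \<Rightarrow> complex. \<forall>\<tau>\<in>upper_half_plane. \<forall>z\<in>tensorC L.
        ((\<lambda>(n, l). f n l * exp (2 * pi * \<i> * (of_rat n * \<tau> + bil L l z)))
          has_sum \<phi> (\<tau>, z)) (fourier_index L t D))"
    (is "(\<exists>f. ?P f) \<longleftrightarrow> (\<exists>f. ?Q f)")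
proof -
  let ?I = "fourier_index L t D" and ?J = "fourier_index (rescale s L) (t / s) D"
  define g :: "rat \<times> (complex^'n) \<Rightarrow> rat \<times> (complex^'n)" where "g = (\<lambda>(n, l). (n, of_rat s *s l))"
  have bij: "bij_betw g ?J ?I"
  proof (rule bij_betw_byWitness[where f' = "\<lambda>(n, l). (n, of_rat (1 / s) *s l)"])
    show "(\<lambda>(n, l). (n, of_rat (1 / s) *s l)) ` ?I \<subseteq> ?J"
      using assms by (auto simp: fourier_index_rescale_iff of_rat_divide)
  qed (use assms in \<open>auto simp: g_def fourier_index_rescale_iff of_rat_divide\<close>)
  have iff: "?P (\<lambda>n l. f n (of_rat s *s l)) \<longleftrightarrow> ?Q f" for f
  proof (intro ball_cong refl)
    fix \<tau> z assume z: "z \<in> tensorC L"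
    have tC: "l \<in> tensorC L" if "(n, l) \<in> ?J" for n l
      using fourier_index_tensorC[OF that] by simp
    show "((\<lambda>(n, l). f n (of_rat s *s l) *
            exp (2 * pi * \<i> * (of_rat n * \<tau> + bil (rescale s L) l z))) has_sum \<phi> (\<tau>, z)) ?J \<longleftrightarrow>
        ((\<lambda>(n, l). f n l * exp (2 * pi * \<i> * (of_rat n * \<tau> + bil L l z))) has_sum \<phi> (\<tau>, z)) ?I"
      unfolding has_sum_reindex_bij_betw[OF bij, symmetric]
      by (rule has_sum_cong) (auto simp: g_def bil_scale_left[OF L tC z])
  qed
  show ?thesis
  proof
    assume "\<exists>f. ?P f"
    then obtain f where "?P f" by blast
    then have "?P (\<lambda>n l. f n (of_rat (1 / s) *s (of_rat s *s l)))"
      using assms(2) by (simp add: of_rat_divide)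
    then have "?Q (\<lambda>n l. f n (of_rat (1 / s) *s l))"
      by (rule iff[THEN iffD1])
    then show "\<exists>f. ?Q f"
      by (rule exI[where x = "\<lambda>n l. f n (of_rat (1 / s) *s l)"])
  next
    assume "\<exists>f. ?Q f"
    then obtain f where "?Q f" by blast
    then have "?P (\<lambda>n l. f n (of_rat s *s l))"
      by (rule iff[THEN iffD2])
    then show "\<exists>f. ?P f"
      by (rule exI[where x = "\<lambda>n l. f n (of_rat s *s l)"])
  qed
qed

lemma jacobi_forms_rescale:
  assumes "is_lattice L" "s > 0"
  shows "jacobi_forms k L t D \<nu> = jacobi_forms k (rescale s L) (t / s) D (transport_char s \<nu>)"
proof -
  have "u * of_rat (t / s) * (c * (of_rat s * w) / j) = u * of_rat t * (c * w / j)"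
    for u c w j :: complex
    using assms(2) by (simp add: of_rat_divide)
  moreover have "u * of_rat (t / s) * (of_rat s * w * \<tau> + 2 * (of_rat s * w')) =
      u * of_rat t * (w * \<tau> + 2 * w')" for u w w' \<tau> :: complex
    using assms(2) by (simp add: of_rat_divide field_simps)
  moreover have "transport_char s \<nu> (x, y, of_rat s * w / 2) = \<nu> (x, y, w / 2)" for x y w
    using assms(2) by (simp add: transport_char_def)
  ultimately show ?thesis
    by (simp only: jacobi_forms_def rescale_simps
        fourier_expansion_rescale_iff[OF assms, unfolded rescale_simps])
qed

section \<open>Characters of the Heisenberg group\<close>

lemma heisenberg_s_gens:
  assumes "is_lattice L" "x \<in> pts L" "y \<in> pts L"
  shows "(x, 0, 0) \<in> heisenberg_s L" "(0, y, 0) \<in> heisenberg_s L"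
  using assms by (auto simp: heisenberg_s_def intro!: generate.incl)

lemma character_mult:
  assumes "\<nu> \<in> characters L" "(x, y, r) \<in> heisenberg_s L" "(x', y', r') \<in> heisenberg_s L"
  shows "\<nu> (x + x', y + y', r + r' + (bil L x y' - bil L x' y) / 2) =
    \<nu> (x, y, r) * \<nu> (x', y', r')"
  using assms hom_mult[of \<nu> "(heisenberg L)\<lparr>carrier := heisenberg_s L\<rparr>" sign_img "(x, y, r)" "(x', y', r')"]
  by (simp add: characters_def heisenberg_def sign_img_def)

lemma character_values:
  assumes "\<nu> \<in> characters L" "g \<in> heisenberg_s L"
  shows "\<nu> g = 1 \<or> \<nu> g = -1"
  using assms by (auto simp: characters_def sign_img_def hom_def)

text \<open>The factorisation \<open>[x,y;(x,y)/2] = [x,0;0] [0,y;0]\<close>.\<close>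

lemma character_split:
  assumes L: "is_lattice L" and nu: "\<nu> \<in> characters L" and xy: "x \<in> pts L" "y \<in> pts L"
  shows "\<nu> (x, y, bil L x y / 2) = \<nu> (x, 0, 0) * \<nu> (0, y, 0)"
  using character_mult[OF nu, of x 0 0 0 y 0] heisenberg_s_gens[OF L] xy
    bil_0_left[OF L tensorC_0] by simp

lemma character_double:
  assumes L: "is_lattice L" and nu: "\<nu> \<in> characters L" and x: "x \<in> pts L"
  shows "\<nu> (2 *s x, 0, 0) = 1" "\<nu> (0, 2 *s x, 0) = 1"
proof -
  have "2 *s x = x + x"
    by (simp add: vec_eq_iff)
  moreover have "\<nu> (x, 0, 0) * \<nu> (x, 0, 0) = 1" "\<nu> (0, x, 0) * \<nu> (0, x, 0) = 1"
    using character_values[OF nu] heisenberg_s_gens[OF L x x] by fastforce+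
  ultimately show "\<nu> (2 *s x, 0, 0) = 1" "\<nu> (0, 2 *s x, 0) = 1"
    using character_mult[OF nu, of x 0 0 x 0 0] character_mult[OF nu, of 0 x 0 0 x 0]
      heisenberg_s_gens[OF L x x] by simp_all
qed

lemma character_zero:
  assumes L: "is_lattice L" and nu: "\<nu> \<in> characters L"
  shows "\<nu> (0, 0, 0) = 1"
  using character_double[OF L nu pts_0[OF L]] by simp

text \<open>The inverse of a generator of \<open>H\<^sub>s(L)\<close> is again a generator.\<close>

lemma heisenberg_inv:
  assumes L: "is_lattice L" and x: "x \<in> pts L"
  shows "inv\<^bsub>heisenberg L\<^esub> (x, 0, 0) = (- x, 0, 0)"
    and "inv\<^bsub>heisenberg L\<^esub> (0, x, 0) = (0, - x, 0)"
proof -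
  have mx: "- x \<in> pts L"
    using pts_scale[OF L x, of "-1"] by (simp add: vec_eq_iff)
  have z: "bil L u 0 = 0" "bil L 0 u = 0" if "u \<in> pts L" for u
    using that by (auto simp: bil_0_left[OF L] bil_0_right[OF L] pts_tensorC)
  show "inv\<^bsub>heisenberg L\<^esub> (x, 0, 0) = (- x, 0, 0)"
    unfolding m_inv_def
  proof (rule the_equality)
    show "(- x, 0, 0) \<in> carrier (heisenberg L) \<and> (x, 0, 0) \<otimes>\<^bsub>heisenberg L\<^esub> (- x, 0, 0) = \<one>\<^bsub>heisenberg L\<^esub> \<and>
        (- x, 0, 0) \<otimes>\<^bsub>heisenberg L\<^esub> (x, 0, 0) = \<one>\<^bsub>heisenberg L\<^esub>"
      using mx x pts_0[OF L] by (simp add: heisenberg_def z)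
  next
    fix g assume g: "g \<in> carrier (heisenberg L) \<and> (x, 0, 0) \<otimes>\<^bsub>heisenberg L\<^esub> g = \<one>\<^bsub>heisenberg L\<^esub> \<and>
        g \<otimes>\<^bsub>heisenberg L\<^esub> (x, 0, 0) = \<one>\<^bsub>heisenberg L\<^esub>"
    obtain u v r where uvr: "g = (u, v, r)" by (cases g)
    have uv: "u \<in> pts L" "v \<in> pts L"
      using g by (auto simp: heisenberg_def uvr)
    have "x + u = 0" "v = 0" "r + (bil L x v - bil L u 0) / 2 = 0"
      using g by (auto simp: heisenberg_def uvr)
    then show "g = (- x, 0, 0)"
      using uv x pts_0[OF L] by (simp add: uvr z eq_neg_iff_add_eq_0 add.commute)
  qed
  show "inv\<^bsub>heisenberg L\<^esub> (0, x, 0) = (0, - x, 0)"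
    unfolding m_inv_def
  proof (rule the_equality)
    show "(0, - x, 0) \<in> carrier (heisenberg L) \<and> (0, x, 0) \<otimes>\<^bsub>heisenberg L\<^esub> (0, - x, 0) = \<one>\<^bsub>heisenberg L\<^esub> \<and>
        (0, - x, 0) \<otimes>\<^bsub>heisenberg L\<^esub> (0, x, 0) = \<one>\<^bsub>heisenberg L\<^esub>"
      using mx x pts_0[OF L] by (simp add: heisenberg_def z)
  next
    fix g assume g: "g \<in> carrier (heisenberg L) \<and> (0, x, 0) \<otimes>\<^bsub>heisenberg L\<^esub> g = \<one>\<^bsub>heisenberg L\<^esub> \<and>
        g \<otimes>\<^bsub>heisenberg L\<^esub> (0, x, 0) = \<one>\<^bsub>heisenberg L\<^esub>"
    obtain u v r where uvr: "g = (u, v, r)" by (cases g)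
    have uv: "u \<in> pts L" "v \<in> pts L"
      using g by (auto simp: heisenberg_def uvr)
    have "u = 0" "x + v = 0" "r + (bil L 0 v - bil L u x) / 2 = 0"
      using g by (auto simp: heisenberg_def uvr)
    then show "g = (0, - x, 0)"
      using uv x pts_0[OF L] by (simp add: uvr z eq_neg_iff_add_eq_0 add.commute)
  qed
qed

lemma char_trivialI:
  assumes L: "is_lattice L" and nu: "\<nu> \<in> characters L"
    and gens: "\<And>x. x \<in> pts L \<Longrightarrow> \<nu> (x, 0, 0) = 1" "\<And>x. x \<in> pts L \<Longrightarrow> \<nu> (0, x, 0) = 1"
  shows "char_trivial L \<nu>"
  unfolding char_trivial_def
proof
  fix g assume "g \<in> heisenberg_s L"
  then show "\<nu> g = 1"
    unfolding heisenberg_s_def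
  proof (induction rule: generate.induct)
    case one
    show ?case
      using character_zero[OF L nu] by (simp add: heisenberg_def)
  next
    case (incl h)
    then show ?case using gens by auto
  next
    case (inv h)
    have "- x \<in> pts L" if "x \<in> pts L" for x
      using pts_scale[OF L that, of "-1"] by (simp add: vec_eq_iff)
    with inv gens show ?case by (auto simp: heisenberg_inv[OF L])
  next
    case (eng g h)
    then have gh: "g \<in> heisenberg_s L" "h \<in> heisenberg_s L"
      by (auto simp: heisenberg_s_def)
    have "\<nu> (g \<otimes>\<^bsub>heisenberg L\<^esub> h) = \<nu> g * \<nu> h"
      using hom_mult[of \<nu> "(heisenberg L)\<lparr>carrier := heisenberg_s L\<rparr>" sign_img g h] nu gh
      by (simp add: characters_def sign_img_def)
    with eng show ?case by simp
  qed
qed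

section \<open>A non-zero Jacobi form determines the Heisenberg character\<close>

lemma jacobi_formsD:
  assumes "\<phi> \<in> jacobi_forms k L t D \<nu>" "\<tau> \<in> upper_half_plane" "z \<in> tensorC L"
  shows jacobi_modular: "a * d - b * c = 1 \<Longrightarrow>
           \<phi> ((of_int a * \<tau> + of_int b) / (of_int c * \<tau> + of_int d),
              (1 / (of_int c * \<tau> + of_int d)) *s z) =
           v_eta a b c d powi D * (of_int c * \<tau> + of_int d) powr of_rat k *
           exp (pi * \<i> * of_rat t * (of_int c * bil L z z / (of_int c * \<tau> + of_int d))) *
           \<phi> (\<tau>, z)"
    and jacobi_heisenberg: "\<lbrakk>x \<in> pts L; y \<in> pts L\<rbrakk> \<Longrightarrow>
        \<phi> (\<tau>, z + \<tau> *s x + y) =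
        of_int (\<nu> (x, y, bil L x y / 2)) *
        exp (- pi * \<i> * of_rat t * (bil L x x * \<tau> + 2 * bil L x z)) * \<phi> (\<tau>, z)"
  using assms unfolding jacobi_forms_def by blast+

text \<open>
  The image of \<open>(\<tau>, z + x \<tau> + x)\<close> under \<open>\<tau> \<mapsto> \<tau> + 1\<close> is \<open>(\<tau> + 1, z + x (\<tau> + 1))\<close>, so the value there
  is obtained in two ways, with Heisenberg factors \<open>\<nu>([x,0;0]) \<nu>([0,x;0])\<close> and \<open>\<nu>([x,0;0])\<close> and with
  exponentials that differ by \<open>exp(-\<pi> i t (x,x))\<close>.
\<close>

lemma jacobi_character_snd:
  assumes L: "is_lattice L" and nu: "\<nu> \<in> characters L" and phi: "\<phi> \<in> jacobi_forms k L t D \<nu>"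
    and tau: "\<tau> \<in> upper_half_plane" and z: "z \<in> tensorC L" and nz: "\<phi> (\<tau>, z) \<noteq> 0"
    and x: "x \<in> pts L"
  shows "of_int (\<nu> (0, x, 0)) = exp (- pi * \<i> * of_rat t * bil L x x)"
proof -
  let ?a = "v_eta 1 1 0 1 powi D"
  let ?z = "z + \<tau> *s x + x"
  have T: "\<phi> (\<tau> + 1, w) = ?a * \<phi> (\<tau>, w)" if "\<tau> \<in> upper_half_plane" "w \<in> tensorC L" for \<tau> w
    using jacobi_modular[OF phi that, of 1 1 1 0] by simp
  \<comment> \<open>The multiplier cannot vanish, since \<open>\<tau> \<mapsto> \<tau> + 1\<close> is onto and \<open>\<phi>\<close> is non-zero somewhere.\<close>
  have "\<phi> (\<tau>, z) = ?a * \<phi> (\<tau> - 1, z)"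
    using T[of "\<tau> - 1" z] tau z by (simp add: upper_half_plane_def)
  with nz have a: "?a \<noteq> 0" by auto
  have n1: "of_int (\<nu> (x, 0, 0)) \<noteq> (0 :: complex)"
    using character_values[OF nu heisenberg_s_gens(1)[OF L x x]] by auto
  have tau1: "\<tau> + 1 \<in> upper_half_plane"
    using tau by (simp add: upper_half_plane_def)
  have "?a * (of_int (\<nu> (x, 0, 0)) * of_int (\<nu> (0, x, 0)) *
      exp (- pi * \<i> * of_rat t * (bil L x x * \<tau> + 2 * bil L x z)) * \<phi> (\<tau>, z)) = \<phi> (\<tau> + 1, ?z)"
    using jacobi_heisenberg[OF phi tau z x x] T[OF tau, of ?z] x z
    by (simp add: character_split[OF L nu] tensorC_add tensorC_scale pts_tensorC)
  also have "?z = z + (\<tau> + 1) *s x + 0"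
    by (simp add: vec.scale_left_distrib)
  also have "\<phi> (\<tau> + 1, \<dots>) = of_int (\<nu> (x, 0, 0)) *
      exp (- pi * \<i> * of_rat t * (bil L x x * (\<tau> + 1) + 2 * bil L x z)) * (?a * \<phi> (\<tau>, z))"
    using jacobi_heisenberg[OF phi tau1 z x pts_0[OF L]] T[OF tau z]
    by (simp only: bil_0_right[OF L pts_tensorC[OF x]]) simp
  also have "exp (- pi * \<i> * of_rat t * (bil L x x * (\<tau> + 1) + 2 * bil L x z)) =
      exp (- pi * \<i> * of_rat t * (bil L x x * \<tau> + 2 * bil L x z)) *
      exp (- pi * \<i> * of_rat t * bil L x x)"
    by (simp add: exp_add[symmetric] algebra_simps)
  finally have "(?a * of_int (\<nu> (x, 0, 0)) * \<phi> (\<tau>, z) *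
        exp (- pi * \<i> * of_rat t * (bil L x x * \<tau> + 2 * bil L x z))) * of_int (\<nu> (0, x, 0)) =
      (?a * of_int (\<nu> (x, 0, 0)) * \<phi> (\<tau>, z) *
        exp (- pi * \<i> * of_rat t * (bil L x x * \<tau> + 2 * bil L x z))) *
      exp (- pi * \<i> * of_rat t * bil L x x)"
    by (simp only: mult_ac)
  moreover have "?a * of_int (\<nu> (x, 0, 0)) * \<phi> (\<tau>, z) *
      exp (- pi * \<i> * of_rat t * (bil L x x * \<tau> + 2 * bil L x z)) \<noteq> 0"
    using a n1 nz by (simp only: mult_eq_0_iff exp_not_eq_zero) simp
  ultimately show ?thesis
    by (rule iffD1[OF mult_left_cancel, rotated])
qed

lemma moebius_upper_half_plane:
  fixes a b c d :: int
  assumes "a * d - b * c = 1" "\<tau> \<in> upper_half_plane"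
  shows "(of_int a * \<tau> + of_int b) / (of_int c * \<tau> + of_int d) \<in> upper_half_plane"
proof -
  have "real_of_int a * real_of_int d - real_of_int b * real_of_int c = 1"
    using assms(1) by (metis of_int_1 of_int_diff of_int_mult)
  moreover have "Im ((of_int a * \<tau> + of_int b) * cnj (of_int c * \<tau> + of_int d)) =
      (real_of_int a * real_of_int d - real_of_int b * real_of_int c) * Im \<tau>"
    by (simp add: algebra_simps)
  ultimately show ?thesis
    using assms(2) by (simp add: upper_half_plane_def Im_complex_div_gt_0)
qed

text \<open>
  The value at \<open>(-1/\<tau>, z/\<tau> + x)\<close> is obtained either by translating by \<open>x\<close> at \<open>-1/\<tau>\<close>, or by
  inverting \<open>(\<tau>, z + x \<tau>)\<close>; in the latter case the exponential of the translation cancels against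
  the expansion of \<open>(z + x \<tau>, z + x \<tau>) / \<tau>\<close>.
\<close>

lemma jacobi_character_fst:
  assumes L: "is_lattice L" and nu: "\<nu> \<in> characters L" and phi: "\<phi> \<in> jacobi_forms k L t D \<nu>"
    and tau: "\<tau> \<in> upper_half_plane" and z: "z \<in> tensorC L" and nz: "\<phi> (\<tau>, z) \<noteq> 0"
    and x: "x \<in> pts L"
  shows "\<nu> (x, 0, 0) = \<nu> (0, x, 0)"
proof -
  let ?b = "v_eta 0 (-1) 1 0 powi D"
  have uhp: "\<tau> \<noteq> 0" "-1 / \<tau> \<in> upper_half_plane" if "\<tau> \<in> upper_half_plane" for \<tau>
    using that moebius_upper_half_plane[of 0 0 "-1" 1 \<tau>] by (auto simp: upper_half_plane_def)
  have S: "\<phi> (-1 / \<tau>, (1 / \<tau>) *s w) =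
      ?b * \<tau> powr of_rat k * exp (pi * \<i> * of_rat t * (bil L w w / \<tau>)) * \<phi> (\<tau>, w)"
    if "\<tau> \<in> upper_half_plane" "w \<in> tensorC L" for \<tau> w
    using jacobi_modular[OF phi that, of 0 0 "-1" 1] by simp
  \<comment> \<open>The multiplier cannot vanish: \<open>(\<tau>, z)\<close> is the image of \<open>(-1/\<tau>, -z/\<tau>)\<close> under the inversion.\<close>
  have "\<phi> (\<tau>, z) \<noteq> 0 \<Longrightarrow> ?b \<noteq> 0"
    using S[OF uhp(2)[OF tau] tensorC_scale[OF z, of "-1 / \<tau>"]] uhp(1)[OF tau] by auto
  with nz have b: "?b * \<tau> powr of_rat k \<noteq> 0"
    using uhp(1)[OF tau] by simp
  have xC: "x \<in> tensorC L" and x': "\<tau> *s x \<in> tensorC L" "z + \<tau> *s x \<in> tensorC L"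
    using x z by (simp_all add: pts_tensorC tensorC_add tensorC_scale)
  let ?e = "exp (pi * \<i> * of_rat t * (bil L z z / \<tau>))"
  have "of_int (\<nu> (0, x, 0)) * (?b * \<tau> powr of_rat k * ?e * \<phi> (\<tau>, z)) =
      of_int (\<nu> (0, x, 0)) * \<phi> (-1 / \<tau>, (1 / \<tau>) *s z)"
    using S[OF tau z] by simp
  also have "\<dots> = \<phi> (-1 / \<tau>, (1 / \<tau>) *s z + x)"
    using jacobi_heisenberg[OF phi uhp(2)[OF tau] tensorC_scale[OF z, of "1 / \<tau>"] pts_0[OF L] x]
      xC z by (simp add: bil_0_left[OF L] tensorC_0 tensorC_scale)
  also have "(1 / \<tau>) *s z + x = (1 / \<tau>) *s (z + \<tau> *s x)"
    using uhp(1)[OF tau] by (simp add: vec.scale_right_distrib)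
  also have "\<phi> (-1 / \<tau>, \<dots>) = ?b * \<tau> powr of_rat k *
      exp (pi * \<i> * of_rat t * (bil L (z + \<tau> *s x) (z + \<tau> *s x) / \<tau>)) * \<phi> (\<tau>, z + \<tau> *s x)"
    by (rule S[OF tau x'(2)])
  also have "\<phi> (\<tau>, z + \<tau> *s x) = of_int (\<nu> (x, 0, 0)) *
      exp (- pi * \<i> * of_rat t * (bil L x x * \<tau> + 2 * bil L x z)) * \<phi> (\<tau>, z)"
    using jacobi_heisenberg[OF phi tau z x pts_0[OF L]]
    by (simp only: bil_0_right[OF L xC]) simp
  also have "bil L (z + \<tau> *s x) (z + \<tau> *s x) / \<tau> =
      bil L z z / \<tau> + (bil L x x * \<tau> + 2 * bil L x z)"
    using xC x' z uhp(1)[OF tau]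
    by (simp add: bil_add_left[OF L] bil_add_right[OF L] bil_scale_left[OF L] bil_scale_right[OF L]
        bil_sym[OF L z xC] field_simps)
  also have "exp (pi * \<i> * of_rat t * (bil L z z / \<tau> + (bil L x x * \<tau> + 2 * bil L x z))) =
      ?e * exp (pi * \<i> * of_rat t * (bil L x x * \<tau> + 2 * bil L x z))"
    by (simp add: exp_add[symmetric] distrib_left)
  finally have "of_int (\<nu> (0, x, 0)) * (?b * \<tau> powr of_rat k * ?e * \<phi> (\<tau>, z)) =
      (exp (pi * \<i> * of_rat t * (bil L x x * \<tau> + 2 * bil L x z)) *
        exp (- pi * \<i> * of_rat t * (bil L x x * \<tau> + 2 * bil L x z))) *
      (of_int (\<nu> (x, 0, 0)) * (?b * \<tau> powr of_rat k * ?e * \<phi> (\<tau>, z)))"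
    by (simp only: mult_ac)
  also have "exp (pi * \<i> * of_rat t * (bil L x x * \<tau> + 2 * bil L x z)) *
        exp (- pi * \<i> * of_rat t * (bil L x x * \<tau> + 2 * bil L x z)) = 1"
    by (simp flip: exp_add)
  finally have "of_int (\<nu> (0, x, 0)) * (?b * \<tau> powr of_rat k * ?e * \<phi> (\<tau>, z)) =
      of_int (\<nu> (x, 0, 0)) * (?b * \<tau> powr of_rat k * ?e * \<phi> (\<tau>, z))"
    by (simp only: mult_1_left)
  then have "(of_int (\<nu> (0, x, 0)) :: complex) = of_int (\<nu> (x, 0, 0))"
    using b nz by auto
  then show ?thesis by simp
qed

lemma jacobi_character:
  assumes "is_lattice L" "\<nu> \<in> characters L" "nontrivial_space L (jacobi_forms k L t D \<nu>)"
    and "x \<in> pts L"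
  shows "\<nu> (x, 0, 0) = \<nu> (0, x, 0)"
    and "of_int (\<nu> (0, x, 0)) = exp (- pi * \<i> * of_rat t * bil L x x)"
proof -
  obtain \<phi> \<tau> z where "\<phi> \<in> jacobi_forms k L t D \<nu>" "\<tau> \<in> upper_half_plane" "z \<in> tensorC L"
    "\<phi> (\<tau>, z) \<noteq> 0"
    using assms(3) by (auto simp: nontrivial_space_def jacobi_domain_def)
  then show "\<nu> (x, 0, 0) = \<nu> (0, x, 0)"
    "of_int (\<nu> (0, x, 0)) = exp (- pi * \<i> * of_rat t * bil L x x)"
    using assms jacobi_character_fst jacobi_character_snd by blast+
qed

lemma exp_minus_pi_int:
  assumes "w = of_int m"
  shows "exp (- pi * \<i> * w) = (if even m then 1 else -1)"
proof -
  have even: "exp (- pi * \<i> * of_int (2 * j)) = 1" for j :: int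
    unfolding exp_eq_1 by (auto intro!: exI[of _ "- j"])
  show ?thesis
  proof (cases "even m")
    case True
    then show ?thesis
      using even assms by (auto elim!: evenE)
  next
    case False
    then obtain j where "m = 2 * j + 1" by (elim oddE)
    then have "- pi * \<i> * w = - pi * \<i> * of_int (2 * j) + - (pi * \<i>)"
      by (simp add: assms algebra_simps)
    then have "exp (- pi * \<i> * w) = 1 * exp (- (pi * \<i>))"
      by (simp only: exp_add even)
    then show ?thesis
      using False by (simp add: exp_minus)
  qed
qed

lemma heisenberg_char_trivial:
  assumes L: "is_lattice L" and nu: "\<nu> \<in> characters L"
    and nt: "nontrivial_space L (jacobi_forms k L t D \<nu>)" and ev: "even_lattice (rescale t L)"
  shows "char_trivial L \<nu>"
proof -
  have "\<nu> (0, x, 0) = 1" if x: "x \<in> pts L" for x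
  proof -
    obtain m :: int where "of_rat t * bil L x x = of_int (2 * m)"
      using ev x by (auto simp: even_lattice_def)
    from exp_minus_pi_int[OF this] jacobi_character(2)[OF L nu nt x] show ?thesis
      by (simp add: mult.assoc)
  qed
  then show ?thesis
    using jacobi_character(1)[OF L nu nt] by (intro char_trivialI[OF L nu]) auto
qed

lemma heisenberg_char_order_2:
  assumes L: "is_lattice L" and nu: "\<nu> \<in> characters L"
    and nt: "nontrivial_space L (jacobi_forms k L t D \<nu>)" and od: "odd_lattice (rescale t L)"
  shows "char_has_order L \<nu> 2"
proof -
  obtain x where x: "x \<in> pts L" and ne: "\<And>m. of_rat t * bil L x x \<noteq> of_int (2 * m)"
    using od by (auto simp: even_lattice_def odd_lattice_def)
  have "of_rat t * bil L x x \<in> \<int>"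
    using bil_int[of "rescale t L" x x] od x by (simp add: odd_lattice_def)
  then obtain m :: int where m: "of_rat t * bil L x x = of_int m"
    by (auto elim: Ints_cases)
  with ne have "odd m" by (metis evenE)
  then have "\<nu> (0, x, 0) \<noteq> 1"
    using exp_minus_pi_int[OF m] jacobi_character(2)[OF L nu nt x] by (auto simp: mult.assoc)
  then have "\<not> char_trivial L \<nu>"
    using heisenberg_s_gens(2)[OF L x x] by (auto simp: char_trivial_def)
  moreover have "char_trivial L (\<lambda>g. \<nu> g ^ 2)"
    using character_values[OF nu] by (fastforce simp: char_trivial_def)
  moreover have "0 < j \<and> j < 2 \<longleftrightarrow> j = 1" for j :: nat
    by auto
  ultimately show ?thesis
    by (simp add: char_has_order_def)
qed

section \<open>Doubling the abelian variable\<close>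

lemma holomorphic_on_domain_double:
  assumes "holomorphic_on_domain \<phi> (jacobi_domain L)"
  shows "holomorphic_on_domain (restrict (\<lambda>(\<tau>, z). \<phi> (\<tau>, 2 *s z)) (jacobi_domain L))
    (jacobi_domain L)"
  unfolding holomorphic_on_domain_def
proof
  fix p assume p: "p \<in> jacobi_domain L"
  \<comment> \<open>The chain rule within the domain, which is mapped into itself.\<close>
  let ?g = "\<lambda>q :: complex \<times> (complex^'a). (fst q, 2 *s snd q)"
  have img: "?g ` jacobi_domain L \<subseteq> jacobi_domain L"
    by (auto simp: jacobi_domain_def tensorC_scale)
  then have "?g p \<in> jacobi_domain L"
    using p by blast
  then obtain \<phi>' where d: "(\<phi> has_derivative \<phi>') (at (?g p) within jacobi_domain L)"
    and lin: "\<And>c u v. \<phi>' (c * u, c *s v) = c * \<phi>' (u, v)"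
    using assms unfolding holomorphic_on_domain_def by blast
  have two: "2 *s v = 2 *\<^sub>R v" for v :: "complex^'a"
    by (simp add: vec_eq_iff scaleR_conv_of_real)
  have "(?g has_derivative ?g) (at p within jacobi_domain L)"
    unfolding two by (auto intro!: derivative_eq_intros)
  from has_derivative_in_compose[OF this has_derivative_subset[OF d img]]
  have "((\<lambda>q. \<phi> (?g q)) has_derivative (\<lambda>q. \<phi>' (?g q))) (at p within jacobi_domain L)" .
  then have "(restrict (\<lambda>(\<tau>, z). \<phi> (\<tau>, 2 *s z)) (jacobi_domain L) has_derivative (\<lambda>q. \<phi>' (?g q)))
      (at p within jacobi_domain L)"
    by (rule has_derivative_transform[rotated 2]) (use p in \<open>auto split: prod.splits\<close>)
  moreover have "\<phi>' (?g (c * u, c *s v)) = c * \<phi>' (?g (u, v))" for c u v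
    using lin[of c u "2 *s v"] by (simp add: mult.commute)
  ultimately show "\<exists>\<phi>'. (restrict (\<lambda>(\<tau>, z). \<phi> (\<tau>, 2 *s z)) (jacobi_domain L) has_derivative \<phi>')
      (at p within jacobi_domain L) \<and> (\<forall>c u v. \<phi>' (c * u, c *s v) = c * \<phi>' (u, v))"
    by blast
qed

lemma fourier_index_double:
  assumes L: "is_lattice L" and I: "(n, l) \<in> fourier_index L t D"
  shows "(n, 2 *s l) \<in> fourier_index L (4 * t) D"
proof -
  have l: "l \<in> tensorC L"
    using I by (rule fourier_index_tensorC)
  then have "bil L (2 *s l) (2 *s l) = 4 * bil L l l"
    by (simp add: bil_scale_left[OF L] bil_scale_right[OF L] tensorC_scale)
  moreover have "2 *s (2 *s l) \<in> dual L"
    using I dual_scale_int[OF L, of "2 *s l" 2] by (simp add: fourier_index_iff)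
  ultimately show ?thesis
    using I by (simp add: fourier_index_iff of_rat_mult)
qed

lemma jacobi_forms_double:
  assumes L: "is_lattice L" and nu: "\<nu> \<in> characters L" and phi: "\<phi> \<in> jacobi_forms k L t D \<nu>"
  shows "restrict (\<lambda>(\<tau>, z). \<phi> (\<tau>, 2 *s z)) (jacobi_domain L) \<in> jacobi_forms k L (4 * t) D (\<lambda>_. 1)"
proof -
  let ?X = "jacobi_domain L"
  let ?\<psi> = "restrict (\<lambda>(\<tau>, z). \<phi> (\<tau>, 2 *s z)) ?X"
  have psi: "?\<psi> (\<tau>, z) = \<phi> (\<tau>, 2 *s z)" if "\<tau> \<in> upper_half_plane" "z \<in> tensorC L" for \<tau> z
    using that by (simp add: jacobi_domain_def)
  have "holomorphic_on_domain \<phi> ?X"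
    using phi by (simp add: jacobi_forms_def)
  then have hol: "holomorphic_on_domain ?\<psi> ?X"
    by (rule holomorphic_on_domain_double)
  have modular: "?\<psi> ((of_int a * \<tau> + of_int b) / (of_int c * \<tau> + of_int d),
              (1 / (of_int c * \<tau> + of_int d)) *s z) =
           v_eta a b c d powi D * (of_int c * \<tau> + of_int d) powr of_rat k *
           exp (pi * \<i> * of_rat (4 * t) * (of_int c * bil L z z / (of_int c * \<tau> + of_int d))) *
           ?\<psi> (\<tau>, z)"
    if abcd: "a * d - b * c = 1" and tau: "\<tau> \<in> upper_half_plane" and z: "z \<in> tensorC L"
    for a b c d \<tau> z
  proof -
    let ?j = "of_int c * \<tau> + of_int d"
    have "?\<psi> ((of_int a * \<tau> + of_int b) / ?j, (1 / ?j) *s z) =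
        \<phi> ((of_int a * \<tau> + of_int b) / ?j, (1 / ?j) *s (2 *s z))"
      by (simp add: psi moebius_upper_half_plane[OF abcd tau] z tensorC_scale del: restrict_apply)
    also have "\<dots> = v_eta a b c d powi D * ?j powr of_rat k *
        exp (pi * \<i> * of_rat t * (of_int c * bil L (2 *s z) (2 *s z) / ?j)) * \<phi> (\<tau>, 2 *s z)"
      by (rule jacobi_modular[OF phi tau tensorC_scale[OF z] abcd])
    also have "bil L (2 *s z) (2 *s z) = 4 * bil L z z"
      using z by (simp add: bil_scale_left[OF L] bil_scale_right[OF L] tensorC_scale)
    also have "pi * \<i> * of_rat t * (of_int c * (4 * bil L z z) / ?j) =
        pi * \<i> * of_rat (4 * t) * (of_int c * bil L z z / ?j)"
      by (simp add: of_rat_mult)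
    finally show ?thesis
      by (simp only: psi[OF tau z])
  qed
  have heis: "?\<psi> (\<tau>, z + \<tau> *s x + y) =
        exp (- pi * \<i> * of_rat (4 * t) * (bil L x x * \<tau> + 2 * bil L x z)) * ?\<psi> (\<tau>, z)"
    if tau: "\<tau> \<in> upper_half_plane" and z: "z \<in> tensorC L" and x: "x \<in> pts L" and y: "y \<in> pts L"
    for \<tau> z x y
  proof -
    have xy: "2 *s x \<in> pts L" "2 *s y \<in> pts L"
      using pts_scale[OF L x, of 2] pts_scale[OF L y, of 2] by simp_all
    have nu1: "\<nu> (2 *s x, 2 *s y, bil L (2 *s x) (2 *s y) / 2) = 1"
      by (simp add: character_split[OF L nu] xy character_double[OF L nu] x y)
    have double: "2 *s (z + \<tau> *s x + y) = 2 *s z + \<tau> *s (2 *s x) + 2 *s y"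
      by (simp add: vec_eq_iff algebra_simps)
    have b: "bil L (2 *s x) (2 *s x) = 4 * bil L x x" "bil L (2 *s x) (2 *s z) = 4 * bil L x z"
      using x z by (simp_all add: bil_scale_left[OF L] bil_scale_right[OF L]
          pts_tensorC tensorC_scale)
    have "\<phi> (\<tau>, 2 *s (z + \<tau> *s x + y)) =
        exp (- pi * \<i> * of_rat t * (4 * bil L x x * \<tau> + 2 * (4 * bil L x z))) * \<phi> (\<tau>, 2 *s z)"
      using jacobi_heisenberg[OF phi tau tensorC_scale[OF z, of 2] xy] unfolding double b nu1 by simp
    also have "- pi * \<i> * of_rat t * (4 * bil L x x * \<tau> + 2 * (4 * bil L x z)) =
        - pi * \<i> * of_rat (4 * t) * (bil L x x * \<tau> + 2 * bil L x z)"
      by (simp add: of_rat_mult algebra_simps)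
    finally show ?thesis
      using tau z x y
      by (simp add: psi tensorC_add tensorC_scale pts_tensorC del: restrict_apply)
  qed
  have fourier: "\<exists>f :: rat \<Rightarrow> complex^'a \<Rightarrow> complex. \<forall>\<tau>\<in>upper_half_plane. \<forall>z\<in>tensorC L.
        ((\<lambda>(n, l). f n l * exp (2 * pi * \<i> * (of_rat n * \<tau> + bil L l z))) has_sum ?\<psi> (\<tau>, z))
          (fourier_index L (4 * t) D)"
  proof -
    let ?I = "fourier_index L t D"
    let ?h = "\<lambda>(n :: rat, l :: complex^'a). (n, 2 *s l)"
    obtain f :: "rat \<Rightarrow> complex^'a \<Rightarrow> complex" where
      f: "\<And>\<tau> z. \<tau> \<in> upper_half_plane \<Longrightarrow> z \<in> tensorC L \<Longrightarrow>
        ((\<lambda>(n, l). f n l * exp (2 * pi * \<i> * (of_rat n * \<tau> + bil L l z))) has_sum \<phi> (\<tau>, z)) ?I"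
      using phi unfolding jacobi_forms_def by blast
    \<comment> \<open>The new coefficients vanish outside the image of the old index set under \<open>l \<mapsto> 2 l\<close>.\<close>
    define f' where "f' n l = (if (n, (1/2) *s l) \<in> ?I then f n ((1/2) *s l) else 0)" for n l
    have "((\<lambda>(n, l). f' n l * exp (2 * pi * \<i> * (of_rat n * \<tau> + bil L l z))) has_sum ?\<psi> (\<tau>, z))
          (fourier_index L (4 * t) D)" (is "(?F has_sum _) _")
      if tau: "\<tau> \<in> upper_half_plane" and z: "z \<in> tensorC L" for \<tau> z
    proof -
      have "((\<lambda>(n, l). f n l * exp (2 * pi * \<i> * (of_rat n * \<tau> + bil L l (2 *s z))))
          has_sum ?\<psi> (\<tau>, z)) ?I"
        using f[OF tau tensorC_scale[OF z, of 2]] by (simp only: psi[OF tau z])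
      also have "?this \<longleftrightarrow> ((\<lambda>p. ?F (?h p)) has_sum ?\<psi> (\<tau>, z)) ?I"
      proof (rule has_sum_cong)
        fix p assume "p \<in> ?I"
        moreover obtain n l where "p = (n, l)" by fastforce
        moreover from calculation have "bil L l (2 *s z) = bil L (2 *s l) z"
          using z fourier_index_tensorC by (metis bil_scale_left[OF L] bil_scale_right[OF L])
        ultimately show "(case p of (n, l) \<Rightarrow> f n l *
            exp (2 * pi * \<i> * (of_rat n * \<tau> + bil L l (2 *s z)))) = ?F (?h p)"
          by (simp add: f'_def)
      qed
      also have "\<dots> \<longleftrightarrow> (?F has_sum ?\<psi> (\<tau>, z)) (?h ` ?I)"
        by (rule has_sum_reindex_bij_betw) (auto simp: bij_betw_def inj_on_def)
      also have "\<dots> \<longleftrightarrow> (?F has_sum ?\<psi> (\<tau>, z)) (fourier_index L (4 * t) D)"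
      proof (rule has_sum_cong_neutral)
        fix p assume p: "p \<in> fourier_index L (4 * t) D - ?h ` ?I"
        obtain n l where nl: "p = (n, l)" by fastforce
        have "(n, (1/2) *s l) \<notin> ?I"
        proof
          assume "(n, (1/2) *s l) \<in> ?I"
          then have "?h (n, (1/2) *s l) \<in> ?h ` ?I" by (rule imageI)
          with p nl show False by simp
        qed
        then show "?F p = 0" by (simp add: nl f'_def)
      qed (use fourier_index_double[OF L] in auto)
      finally show ?thesis .
    qed
    then show ?thesis by blast
  qed
  show ?thesis
    unfolding jacobi_forms_def mem_Collect_eq of_int_1 mult_1_left
    by (intro conjI allI ballI impI restrict_extensional hol modular heis fourier)
qed

section \<open>Equalities of spaces and their characters\<close>

theorem proposition1p3:
  fixes L :: "(complex^'n) lat" and k t :: rat and D :: int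
    and \<nu> :: "(complex^'n) heis \<Rightarrow> int"
  assumes "even_lattice L" and "positive_definite L"
    and "2 * k \<in> \<int>" and "t > 0"
    and "\<nu> \<in> characters L"
  shows
    "(even_lattice (rescale t L) \<longrightarrow>
        jacobi_forms k L t D \<nu> = jacobi_forms k (rescale t L) 1 D (transport_char t \<nu>) \<and>
        (nontrivial_space L (jacobi_forms k L t D \<nu>) \<longrightarrow> char_trivial L \<nu>)) \<and>
     (odd_lattice (rescale t L) \<longrightarrow>
        jacobi_forms k L t D \<nu> =
          jacobi_forms k (rescale (2 * t) L) (1/2) D (transport_char (2 * t) \<nu>) \<and>
        (nontrivial_space L (jacobi_forms k L t D \<nu>) \<longrightarrow> char_has_order L \<nu> 2)) \<and>
     (\<forall>\<phi> \<in> jacobi_forms k L t D \<nu>.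
        restrict (\<lambda>(\<tau>, z). \<phi> (\<tau>, 2 *s z)) (jacobi_domain L)
          \<in> jacobi_forms k L (4 * t) D (\<lambda>_. 1))"
proof -
  have L: "is_lattice L"
    using assms(1) by (simp add: even_lattice_def)
  have "jacobi_forms k L t D \<nu> = jacobi_forms k (rescale t L) 1 D (transport_char t \<nu>)"
    using jacobi_forms_rescale[OF L, of t k t] assms(4) by simp
  moreover have "jacobi_forms k L t D \<nu> =
      jacobi_forms k (rescale (2 * t) L) (1/2) D (transport_char (2 * t) \<nu>)"
    using jacobi_forms_rescale[OF L, of "2 * t" k t] assms(4) by simp
  ultimately show ?thesis
    using heisenberg_char_trivial[OF L assms(5)] heisenberg_char_order_2[OF L assms(5)]
      jacobi_forms_double[OF L assms(5)]
    by blast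
qed

end
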